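(* If a topological dynamical system has the weak specification property, then it has the vague specification property.
   Context: $\mathbb{N}_0=\{0,1,2,\ldots\}$, $\mathbb{N}=\{1,2,\ldots\}$. A topological dynamical system $(X,T)$ consists of a compact metrizable space $X$ and a continuous map $T\colon X\to X$. Fix a compatible metric $\rho$ on $X$ of diameter at most $1$ (the notions below do not depend on this choice). Weak specification property: for every $\varepsilon>0$ there is a nondecreasing function $M_\varepsilon\colon\mathbb{N}\to\mathbb{N}$ with $M_\varepsilon(n)/n\to0$ as $n\to\infty$ such that for every $k\in\mathbb{N}$, all points $x_1,\ldots,x_k\in X$ and all integers $0\le a_1\le b_1<a_2\le b_2<\cdots<a_k\le b_k$ with $a_i-b_{i-1}\ge M_\varepsilon(b_i-a_i+1)$ for $2\le i\le k$, there is $y\in X$ with $\rho(T^j(y),T^j(x_i))\le\varepsilon$ for all $1\le i\le k$ and $a_i\le j\le b_i$. For $A\subseteq\mathbb{N}_0$ we write $d(A)=1$ if $\lim_{n\to\infty}\frac{|A\cap[0,n)|}{n}=1$. $X^\infty$ is the set of all sequences $\underline{x}=\{x_n\}_{n=0}^\infty$ in $X$, with the product topology; $S(\underline{x})=\{x_{n+1}\}_{n=0}^\infty$ is the shift on $X^\infty$. Let $\Gamma_T=\{\{T^n(z)\}_{n=0}^\infty : z\in X\}\subseteq X^\infty$. Vague pseudo-orbit: $\underline{x}\in X^\infty$ such that for every open set $\mathcal{U}\subseteq X^\infty$ containing $\Gamma_T$ one has $d(\{n\in\mathbb{N}_0 : S^n(\underline{x})\in\mathcal{U}\})=1$. Vague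 specification property: for every vague pseudo-orbit $\underline{x}$ in $(X,T)$ there is $z\in X$ such that for every $\varepsilon>0$, $d(\{n\in\mathbb{N}_0 : \rho(T^n(z),x_n)<\varepsilon\})=1$. *)

theory Defs
  imports "HOL-Analysis.Analysis"
begin

text \<open>
  The phase space is an arbitrary topology \<open>X\<close> with carrier \<open>topspace X\<close>; the map \<open>T\<close> and the
  metric \<open>\<rho>\<close> are total functions whose values matter only on that carrier.
\<close>

definition topological_dynamical_system :: "'a topology \<Rightarrow> ('a \<Rightarrow> 'a) \<Rightarrow> bool" where
  "topological_dynamical_system X T \<longleftrightarrow>
     compact_space X \<and> metrizable_space X \<and> continuous_map X X T"

definition compatible_metric :: "'a topology \<Rightarrow> ('a \<Rightarrow> 'a \<Rightarrow> real) \<Rightarrow> bool" where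
  "compatible_metric X \<rho> \<longleftrightarrow>
     Metric_space (topspace X) \<rho> \<and> Metric_space.mtopology (topspace X) \<rho> = X"

text \<open>
  The gap function \<open>M\<close> is a map from the positive integers to the positive integers; its value
  at \<open>0\<close> is irrelevant. The natural-number subtractions below do not truncate, because
  \<open>a i \<le> b i\<close> and \<open>b (i - 1) < a i\<close> are assumed.
\<close>

definition weak_specification ::
    "'a topology \<Rightarrow> ('a \<Rightarrow> 'a \<Rightarrow> real) \<Rightarrow> ('a \<Rightarrow> 'a) \<Rightarrow> bool" where
  "weak_specification X \<rho> T \<longleftrightarrow>
     (\<forall>\<epsilon>>0. \<exists>M :: nat \<Rightarrow> nat.
        M \<in> {1..} \<rightarrow> {1..} \<and> mono_on {1..} M \<and>
        (\<lambda>n. real (M n) / real n) \<longlonglongrightarrow> 0 \<and>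
        (\<forall>k\<ge>1. \<forall>(x :: nat \<Rightarrow> 'a) (a :: nat \<Rightarrow> nat) (b :: nat \<Rightarrow> nat).
           (\<forall>i\<in>{1..k}. x i \<in> topspace X) \<and>
           (\<forall>i\<in>{1..k}. a i \<le> b i) \<and>
           (\<forall>i\<in>{2..k}. b (i - 1) < a i) \<and>
           (\<forall>i\<in>{2..k}. a i - b (i - 1) \<ge> M (b i - a i + 1))
           \<longrightarrow> (\<exists>y\<in>topspace X. \<forall>i\<in>{1..k}. \<forall>j\<in>{a i..b i}.
                  \<rho> ((T ^^ j) y) ((T ^^ j) (x i)) \<le> \<epsilon>)))"

definition density_one :: "nat set \<Rightarrow> bool" where
  "density_one A \<longleftrightarrow> (\<lambda>n. real (card (A \<inter> {0..<n})) / real n) \<longlonglongrightarrow> 1"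

definition sequence_space :: "'a topology \<Rightarrow> (nat \<Rightarrow> 'a) topology" where
  "sequence_space X = product_topology (\<lambda>_. X) UNIV"

definition shift :: "(nat \<Rightarrow> 'a) \<Rightarrow> nat \<Rightarrow> 'a" where
  "shift x = (\<lambda>n. x (Suc n))"

definition orbit_sequences :: "'a topology \<Rightarrow> ('a \<Rightarrow> 'a) \<Rightarrow> (nat \<Rightarrow> 'a) set" where
  "orbit_sequences X T = (\<lambda>z n. (T ^^ n) z) ` topspace X"

definition vague_pseudo_orbit :: "'a topology \<Rightarrow> ('a \<Rightarrow> 'a) \<Rightarrow> (nat \<Rightarrow> 'a) \<Rightarrow> bool" where
  "vague_pseudo_orbit X T x \<longleftrightarrow>
     x \<in> topspace (sequence_space X) \<and>
     (\<forall>U. openin (sequence_space X) U \<and> orbit_sequences X T \<subseteq> U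
        \<longrightarrow> density_one {n. (shift ^^ n) x \<in> U})"

definition vague_specification ::
    "'a topology \<Rightarrow> ('a \<Rightarrow> 'a \<Rightarrow> real) \<Rightarrow> ('a \<Rightarrow> 'a) \<Rightarrow> bool" where
  "vague_specification X \<rho> T \<longleftrightarrow>
     (\<forall>x. vague_pseudo_orbit X T x \<longrightarrow>
        (\<exists>z\<in>topspace X. \<forall>\<epsilon>>0. density_one {n. \<rho> ((T ^^ n) z) (x n) < \<epsilon>}))"

end

(*
  At level k, with precision 2^-k, fix a block length m whose gap g is at most 2^-k * m. A vague
  pseudo-orbit x is, off a set of density zero, close for m steps to an orbit that starts in
  core = INT n. T^n X; points of core are attained at any prescribed time by the orbit of some
  point of X. For a fast growing sequence N_k, weak specification gives points z_k such that
  z_(k+1) traces z_k on [0, N_k) and, after that, x up to N_(k+1), in blocks of length m, with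
  precision 2^-k. The indices missed by the blocks have upper density of order 2^-k. A limit point
  of (z_k) follows x at distance of order 2^-k on [N_k, N_(k+1)) off those indices.
*)
theory Submission
  imports Defs
begin

section \<open>Density one and counting estimates\<close>

text \<open>Exceptional indices are easy to bound, since their counts are subadditive under unions.
  All later density arguments therefore count complements, in a form free of division by
  \<open>n\<close>.\<close>

lemma density_one_iff_card_compl:
  "density_one A \<longleftrightarrow> (\<forall>e>0. \<exists>n0. \<forall>n\<ge>n0. real (card ({0..<n} - A)) \<le> e * real n)"
proof -
  have card: "real (card ({0..<n} - A)) = real n - real (card (A \<inter> {0..<n}))" for n
    using card_Int_Diff[of "{0..<n}" A] by (simp add: Int_commute)
  have eq: "real (card (A \<inter> {0..<n})) / real n - 1 = - (real (card ({0..<n} - A)) / real n)"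
    if "n > 0" for n
    using that by (simp add: card field_simps)
  show ?thesis
  proof
    assume "density_one A"
    show "\<forall>e>0. \<exists>n0. \<forall>n\<ge>n0. real (card ({0..<n} - A)) \<le> e * real n"
    proof (intro allI impI)
      fix e :: real assume "e > 0"
      then obtain n0 where n0: "\<And>n. n \<ge> n0 \<Longrightarrow> \<bar>real (card (A \<inter> {0..<n})) / real n - 1\<bar> < e"
        using \<open>density_one A\<close> unfolding density_one_def LIMSEQ_iff by force
      have "real (card ({0..<n} - A)) \<le> e * real n" if "n \<ge> max 1 n0" for n
      proof -
        have "n > 0" "n \<ge> n0" using that by auto
        then have "real (card ({0..<n} - A)) / real n < e"
          using n0[of n] eq[of n] by auto
        then show ?thesis using \<open>n > 0\<close> by (simp add: field_simps)
      qed
      then show "\<exists>n0. \<forall>n\<ge>n0. real (card ({0..<n} - A)) \<le> e * real n" by blast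
    qed
  next
    assume small: "\<forall>e>0. \<exists>n0. \<forall>n\<ge>n0. real (card ({0..<n} - A)) \<le> e * real n"
    show "density_one A"
      unfolding density_one_def LIMSEQ_iff
    proof (intro allI impI)
      fix e :: real assume "e > 0"
      then obtain n0 where n0: "\<And>n. n \<ge> n0 \<Longrightarrow> real (card ({0..<n} - A)) \<le> e / 2 * real n"
        using small half_gt_zero by blast
      have "\<bar>real (card (A \<inter> {0..<n})) / real n - 1\<bar> < e" if "n \<ge> max 1 n0" for n
      proof -
        have "n > 0" "n \<ge> n0" using that by auto
        then have "real (card ({0..<n} - A)) / real n \<le> e / 2"
          using n0[of n] by (simp add: field_simps)
        moreover have "0 \<le> real (card ({0..<n} - A)) / real n" by simp
        ultimately show ?thesis using eq[OF \<open>n > 0\<close>] \<open>e > 0\<close> by linarith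
      qed
      then show "\<exists>no. \<forall>n\<ge>no. norm (real (card (A \<inter> {0..<n})) / real n - 1) < e"
        unfolding real_norm_def by blast
    qed
  qed
qed

text \<open>An index below \<open>n\<close> outside \<open>B\<close> is either below
  \<open>L\<close> or the translate by \<open>L\<close> of an index outside \<open>A\<close>. The
  first kind adds only the constant \<open>L\<close>. This pays for discarding the first
  \<open>L\<close> terms of an orbit segment.\<close>

lemma density_one_shift:
  assumes "density_one A" and sub: "\<And>n. n \<in> A \<Longrightarrow> n + L \<in> B"
  shows "density_one B"
  unfolding density_one_iff_card_compl
proof (intro allI impI)
  fix e :: real assume "e > 0"
  then obtain n0 where n0: "\<And>n. n \<ge> n0 \<Longrightarrow> real (card ({0..<n} - A)) \<le> e / 2 * real n"
    using assms(1) half_gt_zero unfolding density_one_iff_card_compl by blast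
  have "real (card ({0..<n} - B)) \<le> e * real n" if n: "n \<ge> max n0 (nat \<lceil>2 * real L / e\<rceil>)" for n
  proof -
    have "{0..<n} - B \<subseteq> {0..<L} \<union> (\<lambda>n. n + L) ` ({0..<n} - A)"
    proof
      fix i assume i: "i \<in> {0..<n} - B"
      show "i \<in> {0..<L} \<union> (\<lambda>n. n + L) ` ({0..<n} - A)"
      proof (cases "i < L")
        case False
        then have "i = (i - L) + L" by simp
        moreover from this have "i - L \<notin> A" using sub i by (metis Diff_iff)
        ultimately show ?thesis using i by (auto intro!: image_eqI[of _ _ "i - L"])
      qed simp
    qed
    then have "card ({0..<n} - B) \<le> card ({0..<L} \<union> (\<lambda>n. n + L) ` ({0..<n} - A))"
      by (intro card_mono) auto
    also have "\<dots> \<le> card {0..<L} + card ((\<lambda>n. n + L) ` ({0..<n} - A))" by (rule card_Un_le)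
    also have "\<dots> \<le> L + card ({0..<n} - A)" using card_image_le[of "{0..<n} - A"] by simp
    finally have "real (card ({0..<n} - B)) \<le> real L + e / 2 * real n"
      using n0[of n] n by simp
    moreover have "real L \<le> e / 2 * real n"
    proof -
      have "2 * real L / e \<le> real n" using n by linarith
      then show ?thesis using \<open>e > 0\<close> by (simp add: field_simps)
    qed
    ultimately show ?thesis by (simp add: field_simps)
  qed
  then show "\<exists>n0. \<forall>n\<ge>n0. real (card ({0..<n} - B)) \<le> e * real n" by blast
qed

text \<open>Time is cut into periods of length \<open>P\<close>, each a gap of length
  \<open>g\<close> followed by a block. Gap indices are coded by quotient and residue. Any other
  index counted here is coded by the start \<open>P * q + g\<close> of its block, which is outside
  \<open>G\<close>, and its residue, so a bad start spoils at most \<open>P\<close> indices.\<close>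

lemma card_bad_blocks_le:
  fixes P g n :: nat
  assumes "P > 0"
  shows "card ({i. i mod P < g \<or> P * (i div P) + g \<notin> G} \<inter> {0..<n})
           \<le> (n div P + 1) * g + card ({0..<n + g} - G) * P"
proof -
  let ?S = "(\<lambda>(q, r). P * q + r) ` ({0..n div P} \<times> {0..<g})"
  let ?R = "(\<lambda>(s, r). s - g + r) ` (({0..<n + g} - G) \<times> {0..<P})"
  have "{i. i mod P < g \<or> P * (i div P) + g \<notin> G} \<inter> {0..<n} \<subseteq> ?S \<union> ?R"
  proof
    fix i assume i: "i \<in> {i. i mod P < g \<or> P * (i div P) + g \<notin> G} \<inter> {0..<n}"
    have le: "P * (i div P) \<le> i" by simp
    show "i \<in> ?S \<union> ?R"
    proof (cases "i mod P < g")
      case True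
      then show ?thesis using i
        by (intro UnI1 image_eqI[of _ _ "(i div P, i mod P)"]) (auto intro: div_le_mono)
    next
      case False
      then show ?thesis using i assms le
        by (intro UnI2 image_eqI[of _ _ "(P * (i div P) + g, i mod P)"]) (auto intro: le_less_trans[OF le])
    qed
  qed
  then have "card ({i. i mod P < g \<or> P * (i div P) + g \<notin> G} \<inter> {0..<n}) \<le> card (?S \<union> ?R)"
    by (intro card_mono) auto
  also have "\<dots> \<le> card ?S + card ?R" by (rule card_Un_le)
  also have "\<dots> \<le> card ({0..n div P} \<times> {0..<g}) + card (({0..<n + g} - G) \<times> {0..<P})"
    by (intro add_mono card_image_le) auto
  finally show ?thesis by (simp add: card_cartesian_product)
qed

text \<open>For \<open>n\<close> in \<open>[N k, N (k+1))\<close> with \<open>k = l + 1\<close>, the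
  stretch \<open>[0, N l)\<close> is negligible because \<open>2 ^ l * N l\<close> is at most
  \<open>N k\<close>, hence at most \<open>n\<close>. The misses on \<open>[N l, N k)\<close> and
  \<open>[N k, n)\<close> lie in \<open>F l\<close> and \<open>F k\<close>, whose counts at
  \<open>n\<close> are controlled because \<open>n\<close> is past both \<open>N l\<close> and
  \<open>N k\<close>.\<close>

lemma density_one_glue:
  fixes N :: "nat \<Rightarrow> nat" and F :: "nat \<Rightarrow> nat set" and C :: real
  assumes "strict_mono N"
    and growth: "\<And>k. 2 ^ k * N k \<le> N (Suc k)"
    and card_F: "\<And>k n. N k \<le> n \<Longrightarrow> real (card (F k \<inter> {0..<n})) \<le> C * (1/2) ^ k * real n"
    and sub: "\<And>k. k \<ge> k0 \<Longrightarrow> {N k..<N (Suc k)} - A \<subseteq> F k"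
  shows "density_one A"
  unfolding density_one_iff_card_compl
proof (intro allI impI)
  fix e :: real assume e: "e > 0"
  have C: "C \<ge> 0"
  proof -
    have "0 \<le> C * (1/2) ^ 0 * real (Suc (N 0))"
      using card_F[of 0 "Suc (N 0)"] of_nat_0_le_iff order_trans le_SucI by blast
    then show ?thesis by (simp add: zero_le_mult_iff del: of_nat_Suc)
  qed
  \<comment> \<open>The factor \<open>1 + 2 * C\<close> adds up the initial stretch, contributing 1,
    and the two exceptional sets, contributing \<open>C\<close> each.\<close>
  obtain K where K: "(1/2) ^ K < e / (1 + 2 * C)"
    using real_arch_pow_inv[of "e / (1 + 2 * C)" "1/2"] e C by auto
  have "real (card ({0..<n} - A)) \<le> e * real n" if n: "n \<ge> N (Suc (max K k0))" for n
  proof -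
    define k where "k = (GREATEST k. N k \<le> n)"
    have bdd: "\<And>k. N k \<le> n \<Longrightarrow> k \<le> n"
      using strict_mono_imp_increasing[OF assms(1)] order_trans by blast
    have k1: "N k \<le> n"
      unfolding k_def by (rule GreatestI_nat[of "\<lambda>k. N k \<le> n", OF n]) (use bdd in blast)
    have k2: "Suc (max K k0) \<le> k"
      unfolding k_def by (rule Greatest_le_nat[of "\<lambda>k. N k \<le> n", OF n]) (use bdd in blast)
    have k3: "n < N (Suc k)"
    proof (rule ccontr)
      assume "\<not> ?thesis"
      then have "Suc k \<le> k"
        unfolding k_def by (intro Greatest_le_nat[of "\<lambda>k. N k \<le> n"]) (use bdd in auto)
      then show False by simp
    qed
    \<comment> \<open>Only stages before \<open>l\<close> may be counted in full: \<open>N k\<close>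
      itself can be as large as \<open>n\<close>, so stage \<open>l\<close> needs its exceptional
      set.\<close>
    obtain l where l: "k = Suc l" "l \<ge> K" "l \<ge> k0" using k2 by (cases k) auto
    have "{0..<n} - A \<subseteq> {0..<N l} \<union> (F l \<inter> {0..<n}) \<union> (F k \<inter> {0..<n})"
    proof
      fix i assume i: "i \<in> {0..<n} - A"
      consider "i < N l" | "N l \<le> i" "i < N (Suc l)" | "N k \<le> i" by (metis l(1) not_le)
      then show "i \<in> {0..<N l} \<union> (F l \<inter> {0..<n}) \<union> (F k \<inter> {0..<n})"
      proof cases
        case 2
        then show ?thesis using sub[of l] i l by fastforce
      next
        case 3
        then show ?thesis using sub[of k] i k3 l by fastforce
      qed simp
    qed
    then have "card ({0..<n} - A) \<le> card ({0..<N l} \<union> (F l \<inter> {0..<n}) \<union> (F k \<inter> {0..<n}))"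
      by (intro card_mono) auto
    also have "\<dots> \<le> N l + card (F l \<inter> {0..<n}) + card (F k \<inter> {0..<n})"
      by (intro order_trans[OF card_Un_le] add_mono) simp_all
    finally have "real (card ({0..<n} - A))
        \<le> real (N l) + real (card (F l \<inter> {0..<n})) + real (card (F k \<inter> {0..<n}))"
      by linarith
    moreover have "real (N l) \<le> (1/2) ^ l * real n"
    proof -
      have "2 ^ l * N l \<le> n" using growth[of l] k1 l by simp
      then have "2 ^ l * real (N l) \<le> real n" by (metis of_nat_le_iff of_nat_mult of_nat_numeral of_nat_power)
      then show ?thesis by (simp add: field_simps)
    qed
    moreover have "real (card (F l \<inter> {0..<n})) \<le> C * (1/2) ^ l * real n"
      using k1 l strict_monoD[OF assms(1), of l k] by (intro card_F) auto
    moreover have "real (card (F k \<inter> {0..<n})) \<le> C * (1/2) ^ l * real n"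
    proof -
      have "real (card (F k \<inter> {0..<n})) \<le> C * (1/2) ^ k * real n" by (rule card_F[OF k1])
      also have "\<dots> \<le> C * (1/2) ^ l * real n"
        using l C by (intro mult_right_mono mult_left_mono power_decreasing) auto
      finally show ?thesis .
    qed
    ultimately have "real (card ({0..<n} - A)) \<le> (1 + 2 * C) * (1/2) ^ l * real n"
      by (simp add: algebra_simps)
    also have "\<dots> \<le> (1 + 2 * C) * (e / (1 + 2 * C)) * real n"
    proof -
      have "(1/2::real) ^ l \<le> (1/2) ^ K" using l by (intro power_decreasing) auto
      with K have "(1/2) ^ l \<le> e / (1 + 2 * C)" by linarith
      then show ?thesis using C by (intro mult_right_mono mult_left_mono) auto
    qed
    finally show ?thesis using C by simp
  qed
  then show "\<exists>n0. \<forall>n\<ge>n0. real (card ({0..<n} - A)) \<le> e * real n" by blast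
qed

section \<open>Iterates on a compact metric space and the core\<close>

lemma funpow_shift: "(shift ^^ n) x = (\<lambda>i. x (n + i))"
  by (induction n) (auto simp: shift_def)

locale compact_dynamics = Metric_space M d for M :: "'a set" and d +
  fixes T :: "'a \<Rightarrow> 'a"
  assumes compact: "compact_space mtopology"
    and continuous: "continuous_map mtopology mtopology T"
begin

lemma continuous_funpow: "continuous_map mtopology mtopology (T ^^ n)"
proof (induction n)
  case (Suc n)
  then show ?case using continuous_map_compose[OF _ continuous] by (simp add: comp_def)
qed (simp add: id_def)

lemma funpow_in [simp, intro]: "x \<in> M \<Longrightarrow> (T ^^ n) x \<in> M"
  using continuous_map_image_subset_topspace[OF continuous_funpow] by fastforce

text \<open>
  The map need not be surjective, so a point has an \<open>n\<close>-th preimage for every \<open>n\<close> only if it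
  lies in the following set.
\<close>
definition core :: "'a set" where "core = (\<Inter>n. (T ^^ n) ` M)"

lemma core_subset: "core \<subseteq> M"
  unfolding core_def by (auto dest: INT_D[of _ _ _ 0])

lemma closedin_image_funpow: "closedin mtopology ((T ^^ n) ` M)"
  using image_compactin[OF compact[unfolded compact_space_def] continuous_funpow]
  by (auto intro: compactin_imp_closedin Hausdorff_space_mtopology)

lemma limitin_funpow:
  assumes "limitin mtopology u c sequentially" "e > 0"
  shows "\<forall>\<^sub>F k in sequentially. d ((T ^^ i) (u k)) ((T ^^ i) c) < e"
  using continuous_map_limit[OF continuous_funpow assms(1), of i] assms(2)
  by (auto simp: limitin_metric elim: eventually_mono)

lemma core_approximates:
  assumes "e > 0"
  shows "\<exists>L. \<forall>w\<in>M. \<exists>c\<in>core. \<forall>i<m. d ((T ^^ (L + i)) w) ((T ^^ i) c) < e"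
proof (rule ccontr)
  assume "\<not> ?thesis"
  then obtain w where w: "\<And>L. w L \<in> M"
    and far: "\<And>L c. c \<in> core \<Longrightarrow> \<exists>i<m. \<not> d ((T ^^ (L + i)) (w L)) ((T ^^ i) c) < e"
    by metis
  define u where "u L = (T ^^ L) (w L)" for L
  have "range u \<subseteq> M" using w by (auto simp: u_def)
  then obtain c r where r: "strict_mono r" and lim: "limitin mtopology (u \<circ> r) c sequentially"
    using compact unfolding compact_space_sequentially by blast
  have "c \<in> (T ^^ n) ` M" for n
  proof (rule limitin_closedin[OF lim closedin_image_funpow])
    show "\<forall>\<^sub>F k in sequentially. (u \<circ> r) k \<in> (T ^^ n) ` M"
    proof (rule eventually_sequentiallyI[of n])
      fix k assume "n \<le> k"
      then have "n \<le> r k" using strict_mono_imp_increasing[OF r] order_trans by blast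
      then have "u (r k) = (T ^^ n) ((T ^^ (r k - n)) (w (r k)))"
        unfolding u_def by (metis comp_apply funpow_add le_add_diff_inverse)
      then show "(u \<circ> r) k \<in> (T ^^ n) ` M" using w by auto
    qed
  qed simp
  then have c: "c \<in> core" unfolding core_def by blast
  have "\<forall>\<^sub>F k in sequentially. \<forall>i\<in>{..<m}. d ((T ^^ i) ((u \<circ> r) k)) ((T ^^ i) c) < e"
    using limitin_funpow[OF lim assms] by (intro eventually_ball_finite) auto
  then obtain k where k: "\<And>i. i < m \<Longrightarrow> d ((T ^^ i) (u (r k))) ((T ^^ i) c) < e"
    by (auto simp: eventually_sequentially)
  have "(T ^^ i) (u (r k)) = (T ^^ (r k + i)) (w (r k))" for i
    unfolding u_def by (metis add.commute comp_apply funpow_add)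
  then show False using k far[OF c, of "r k"] by auto
qed

section \<open>Vague pseudo-orbits follow the core\<close>

lemma vague_pseudo_orbit_in: "vague_pseudo_orbit mtopology T x \<Longrightarrow> x i \<in> M"
  unfolding vague_pseudo_orbit_def sequence_space_def by (auto simp: PiE_iff)

text \<open>The definition of a vague pseudo-orbit is applied to a union of cylinders around true
  orbits. It yields closeness to an orbit of some \<open>w\<close> in \<open>M\<close>, not in
  \<open>core\<close>; dropping the first \<open>L\<close> terms replaces \<open>w\<close> by a
  point of \<open>core\<close>.\<close>

lemma pseudo_orbit_near_core:
  assumes x: "vague_pseudo_orbit mtopology T x" and e: "e > 0"
  shows "density_one {s. \<exists>c\<in>core. \<forall>i<m. d (x (s + i)) ((T ^^ i) c) < e}"
proof -
  note xM = vague_pseudo_orbit_in[OF x]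
  obtain L where L: "\<And>w. w \<in> M \<Longrightarrow> \<exists>c\<in>core. \<forall>i<m. d ((T ^^ (L + i)) w) ((T ^^ i) c) < e / 2"
    using core_approximates[of "e / 2" m] e by auto
  \<comment> \<open>The cylinder constrains \<open>L + m\<close> coordinates: \<open>L\<close> to be
    dropped and \<open>m\<close> for the block that remains.\<close>
  define B where "B w = (\<Pi>\<^sub>E i\<in>UNIV. if i < L + m then mball ((T ^^ i) w) (e / 2) else M)" for w
  have "openin (sequence_space mtopology) (B w)" for w
    unfolding sequence_space_def B_def
  proof (rule product_topology_basis)
    show "finite {i. (if i < L + m then mball ((T ^^ i) w) (e / 2) else M) \<noteq> topspace mtopology}"
      by (rule finite_subset[of _ "{..<L + m}"]) auto
  qed auto
  then have "openin (sequence_space mtopology) (\<Union>w\<in>M. B w)" by blast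
  moreover have "orbit_sequences mtopology T \<subseteq> (\<Union>w\<in>M. B w)"
    using e unfolding orbit_sequences_def B_def by (auto simp: PiE_iff)
  ultimately have "density_one {n. (shift ^^ n) x \<in> (\<Union>w\<in>M. B w)}"
    using x unfolding vague_pseudo_orbit_def by blast
  then show ?thesis
  proof (rule density_one_shift[where L = L])
    fix n assume "n \<in> {n. (shift ^^ n) x \<in> (\<Union>w\<in>M. B w)}"
    then obtain w where w: "w \<in> M" and B: "(\<lambda>i. x (n + i)) \<in> B w"
      by (auto simp: funpow_shift)
    have near: "d ((T ^^ i) w) (x (n + i)) < e / 2" if "i < L + m" for i
      using PiE_mem[OF B[unfolded B_def], of i] that by simp
    obtain c where c: "c \<in> core" "\<And>i. i < m \<Longrightarrow> d ((T ^^ (L + i)) w) ((T ^^ i) c) < e / 2"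
      using L[OF w] by blast
    have "d (x (n + L + i)) ((T ^^ i) c) < e" if "i < m" for i
    proof -
      have "d (x (n + L + i)) ((T ^^ i) c)
          \<le> d (x (n + L + i)) ((T ^^ (L + i)) w) + d ((T ^^ (L + i)) w) ((T ^^ i) c)"
        using xM w c core_subset by (intro triangle) auto
      then show ?thesis
        using c(2)[OF that] near[of "L + i"] that commute[of "x (n + L + i)"]
        by (simp add: add.assoc)
    qed
    then show "n + L \<in> {s. \<exists>c\<in>core. \<forall>i<m. d (x (s + i)) ((T ^^ i) c) < e}"
      using c by blast
  qed
qed

section \<open>Tracing blocks by weak specification\<close>

text \<open>
  The gap before a segment depends only on the length of the segment after it. Hence an initial
  orbit segment of any length \<open>N\<close> can be followed by blocks of a fixed length \<open>m\<close> with gaps of a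
  fixed length \<open>g\<close>. The blocks occupy the residues \<open>g, \<dots>, g + m - 1\<close> modulo \<open>g + m\<close>.
\<close>
lemma weak_specification_blocks:
  assumes weak: "weak_specification mtopology d T" and e: "e > 0"
  obtains m g where "m \<ge> 1" "real g \<le> e * real m"
    and "\<And>(N::nat) N' z c. N \<ge> 1 \<Longrightarrow> z \<in> M \<Longrightarrow> (\<And>j. c j \<in> core) \<Longrightarrow>
      \<exists>y\<in>M. (\<forall>n<N. d ((T ^^ n) y) ((T ^^ n) z) \<le> e) \<and>
        (\<forall>n. N + (g + m) \<le> n \<and> n < N' \<and> g \<le> n mod (g + m) \<longrightarrow>
           d ((T ^^ n) y) ((T ^^ (n mod (g + m) - g)) (c (n div (g + m)))) \<le> e)"
proof -
  obtain \<gamma> where pos: "\<gamma> \<in> {1..} \<rightarrow> {1..}" and lim: "(\<lambda>n. real (\<gamma> n) / real n) \<longlonglongrightarrow> 0"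
    and tr: "\<forall>k\<ge>1. \<forall>(x :: nat \<Rightarrow> 'a) (a :: nat \<Rightarrow> nat) (b :: nat \<Rightarrow> nat).
      (\<forall>i\<in>{1..k}. x i \<in> M) \<and> (\<forall>i\<in>{1..k}. a i \<le> b i) \<and> (\<forall>i\<in>{2..k}. b (i - 1) < a i) \<and>
      (\<forall>i\<in>{2..k}. a i - b (i - 1) \<ge> \<gamma> (b i - a i + 1)) \<longrightarrow>
      (\<exists>y\<in>M. \<forall>i\<in>{1..k}. \<forall>j\<in>{a i..b i}. d ((T ^^ j) y) ((T ^^ j) (x i)) \<le> e)"
    using weak[unfolded weak_specification_def topspace_mtopology, THEN spec, THEN mp, OF e]
    by (elim exE conjE) (rule that)
  note trace = tr[THEN spec, THEN mp, THEN spec, THEN spec, THEN spec, THEN mp, OF _ conjI[OF _ conjI[OF _ conjI]]]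
  have "\<forall>\<^sub>F n in sequentially. real (\<gamma> n) / real n < e" using order_tendstoD(2)[OF lim e] .
  then obtain n0 where "\<forall>n\<ge>n0. real (\<gamma> n) / real n < e" unfolding eventually_sequentially ..
  then obtain m where m: "m \<ge> 1" "real (\<gamma> m) / real m < e" by (meson nle_le)
  define g where "g = \<gamma> m"
  define P where "P = g + m"
  have P: "P > 0" and g: "g \<ge> 1" using m(1) pos by (auto simp: P_def g_def Pi_iff)
  show ?thesis
  proof (rule that[of m g])
    show "real g \<le> e * real m" using m by (simp add: g_def field_simps)
    fix N N' :: nat and z and c :: "nat \<Rightarrow> 'a"
    assume N: "N \<ge> 1" and z: "z \<in> M" and c: "\<And>j. c j \<in> core"
    \<comment> \<open>The first period that starts after the initial segment \<open>[0, N)\<close>;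
      all blocks used have index at least \<open>j0\<close>.\<close>
    define j0 where "j0 = N div P + 1"
    have Nj0: "N < P * j0"
      using mult_div_mod_eq[of P N] mod_less_divisor[OF P, of N] unfolding j0_def distrib_left
      by linarith
    \<comment> \<open>Weak specification compares orbits at equal absolute times, so the block needs
      a point \<open>w j\<close> whose orbit reaches \<open>c j\<close> exactly at time
      \<open>P * j + g\<close>. Membership in \<open>core\<close> provides it.\<close>
    have "c j \<in> (T ^^ (P * j + g)) ` M" for j using c[of j] by (simp add: core_def)
    then have "\<forall>j. \<exists>w. w \<in> M \<and> (T ^^ (P * j + g)) w = c j" by (metis imageE)
    then obtain w where "\<forall>j. w j \<in> M \<and> (T ^^ (P * j + g)) (w j) = c j" unfolding choice_iff ..
    then have w: "w j \<in> M" "(T ^^ (P * j + g)) (w j) = c j" for j by blast+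
    \<comment> \<open>Segment 1 is the initial one, with closed right end \<open>N - 1\<close>.
      Segment \<open>i\<close>, for \<open>i\<close> at least 2, is block
      \<open>j0 + i - 2\<close>.\<close>
    define a where "a i = (if i \<le> 1 then 0 else P * (j0 + i - 2) + g)" for i
    define b where "b i = (if i \<le> 1 then N - 1 else P * (j0 + i - 2) + (P - 1))" for i
    define p where "p i = (if i \<le> 1 then z else w (j0 + i - 2))" for i
    have block: "b i - a i + 1 = m \<and> b (i - 1) < a i \<and> a i - b (i - 1) \<ge> g" if i: "i \<ge> 2" for i
    proof (cases "i = 2")
      case True
      then have "a i = P * j0 + g" "b i = P * j0 + (P - 1)" "b (i - 1) = N - 1"
        by (simp_all add: a_def b_def)
      then show ?thesis using N Nj0 m(1) g P_def by linarith
    next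
      case False
      define q where "q = j0 + (i - 3)"
      have "j0 + i - 2 = Suc q" "j0 + (i - 1) - 2 = q" "i > 2" "\<not> i - 1 \<le> 1"
        using False i by (auto simp: q_def)
      then have "a i = P * q + P + g" "b i = P * q + P + (P - 1)" "b (i - 1) = P * q + (P - 1)"
        by (simp_all add: a_def b_def)
      then show ?thesis using m(1) g P_def by linarith
    qed
    \<comment> \<open>Besides the initial segment this takes \<open>N'\<close> blocks, enough to
      include every block from \<open>j0\<close> on that contains an index below
      \<open>N'\<close>.\<close>
    have "\<exists>y\<in>M. \<forall>i\<in>{1..N' + 1}. \<forall>j\<in>{a i..b i}. d ((T ^^ j) y) ((T ^^ j) (p i)) \<le> e"
    proof (rule trace)
      show "\<forall>i\<in>{2..N' + 1}. \<gamma> (b i - a i + 1) \<le> a i - b (i - 1)"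
        using block by (auto simp: g_def)
      show "\<forall>i\<in>{1..N' + 1}. a i \<le> b i" using m(1) by (auto simp: a_def b_def P_def)
    qed (use block z w in \<open>auto simp: p_def\<close>)
    then obtain y where y: "y \<in> M"
      "\<And>i j. 1 \<le> i \<Longrightarrow> i \<le> N' + 1 \<Longrightarrow> a i \<le> j \<Longrightarrow> j \<le> b i \<Longrightarrow> d ((T ^^ j) y) ((T ^^ j) (p i)) \<le> e"
      by fastforce
    have "d ((T ^^ n) y) ((T ^^ n) z) \<le> e" if "n < N" for n
      using y(2)[of 1 n] that by (simp add: a_def b_def p_def)
    moreover have "d ((T ^^ n) y) ((T ^^ (n mod P - g)) (c (n div P))) \<le> e"
      if n: "N + P \<le> n" "n < N'" "g \<le> n mod P" for n
    proof -
      \<comment> \<open>The threshold \<open>N + P\<close> is chosen so that its quotient by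
        \<open>P\<close> is exactly \<open>j0\<close>.\<close>
      have "(N + P) div P \<le> n div P" using n(1) by (rule div_le_mono)
      then have j: "j0 \<le> n div P" using P by (simp add: j0_def)
      have "n div P \<le> n" by simp
      define i where "i = n div P - j0 + 2"
      have ji: "j0 + i - 2 = n div P" and i2: "\<not> i \<le> 1" using j by (auto simp: i_def)
      have ni: "n = P * (n div P) + n mod P" by simp
      have "n mod P \<le> P - 1" using mod_less_divisor[OF P, of n] by linarith
      moreover have "a i = P * (n div P) + g" "b i = P * (n div P) + (P - 1)"
        using i2 by (simp_all add: a_def b_def ji)
      ultimately have "a i \<le> n" "n \<le> b i" using n(3) ni by linarith+
      moreover have "i \<le> N' + 1" using \<open>n div P \<le> n\<close> n(2) j unfolding i_def j0_def by linarith
      ultimately have "d ((T ^^ n) y) ((T ^^ n) (p i)) \<le> e" using y(2)[of i n] i2 by simp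
      moreover have "(T ^^ n) (p i) = (T ^^ (n mod P - g)) (c (n div P))"
      proof -
        have "n = (n mod P - g) + (P * (n div P) + g)" using n(3) ni by linarith
        then have "(T ^^ n) (w (n div P))
            = (T ^^ (n mod P - g)) ((T ^^ (P * (n div P) + g)) (w (n div P)))"
          by (metis comp_apply funpow_add)
        then show ?thesis using w(2) i2 by (simp add: p_def ji)
      qed
      ultimately show ?thesis by simp
    qed
    ultimately show "\<exists>y\<in>M. (\<forall>n<N. d ((T ^^ n) y) ((T ^^ n) z) \<le> e) \<and>
        (\<forall>n. N + (g + m) \<le> n \<and> n < N' \<and> g \<le> n mod (g + m) \<longrightarrow>
           d ((T ^^ n) y) ((T ^^ (n mod (g + m) - g)) (c (n div (g + m)))) \<le> e)"
      using y(1) unfolding P_def by blast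
  qed (use m in auto)
qed

text \<open>The exceptional set \<open>E\<close> does not depend on \<open>N\<close>, so \<open>N\<close> may later be chosen in terms of \<open>E\<close>.\<close>
lemma tracing_step:
  assumes weak: "weak_specification mtopology d T" and x: "vague_pseudo_orbit mtopology T x"
    and e: "e > 0"
  shows "\<exists>P E Q. (\<forall>n\<ge>Q. real (card (E \<inter> {0..<n}) + P) \<le> 4 * e * real n) \<and>
    (\<forall>(N::nat) N' z. N \<ge> 1 \<and> z \<in> M \<longrightarrow>
      (\<exists>y\<in>M. (\<forall>n<N. d ((T ^^ n) y) ((T ^^ n) z) \<le> e) \<and>
        (\<forall>n. N + P \<le> n \<and> n < N' \<and> n \<notin> E \<longrightarrow> d ((T ^^ n) y) (x n) \<le> 2 * e)))"
proof -
  note xM = vague_pseudo_orbit_in[OF x]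
  obtain m g where m: "m \<ge> 1" "real g \<le> e * real m"
    and trace: "\<And>(N::nat) N' z c. N \<ge> 1 \<Longrightarrow> z \<in> M \<Longrightarrow> (\<And>j. c j \<in> core) \<Longrightarrow>
      \<exists>y\<in>M. (\<forall>n<N. d ((T ^^ n) y) ((T ^^ n) z) \<le> e) \<and>
        (\<forall>n. N + (g + m) \<le> n \<and> n < N' \<and> g \<le> n mod (g + m) \<longrightarrow>
           d ((T ^^ n) y) ((T ^^ (n mod (g + m) - g)) (c (n div (g + m)))) \<le> e)"
    by (rule weak_specification_blocks[OF weak e]) blast
  define P where "P = g + m"
  have P: "P > 0" using m by (simp add: P_def)
  define G where "G = {s. \<exists>c\<in>core. \<forall>i<m. d (x (s + i)) ((T ^^ i) c) < e}"
  \<comment> \<open>Gap indices, together with the whole periods whose block starts at a time where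
    \<open>x\<close> is not known to follow \<open>core\<close>.\<close>
  define E where "E = {i. i mod P < g \<or> P * (i div P) + g \<notin> G}"
  have "density_one G" unfolding G_def by (rule pseudo_orbit_near_core[OF x e])
  \<comment> \<open>Each bad start costs \<open>P\<close> indices and starts are counted up to
    \<open>n + g\<close>, at most \<open>2 * n\<close>; this tolerance makes the total cost at most
    \<open>e * n\<close>.\<close>
  moreover have "e / (2 * P) > 0" using e P by simp
  ultimately obtain n0
    where n0: "\<And>n. n \<ge> n0 \<Longrightarrow> real (card ({0..<n} - G)) \<le> e / (2 * P) * real n"
    unfolding density_one_iff_card_compl by blast
  \<comment> \<open>Past \<open>Q\<close>, both \<open>P\<close> and \<open>g\<close> are at most
    \<open>e / 2 * n\<close>. Gaps then cost at most \<open>3 / 2 * e * n\<close>, bad starts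
    \<open>e * n\<close> and the extra \<open>P\<close> another \<open>e / 2 * n\<close>, which is
    within \<open>4 * e * n\<close>.\<close>
  define Q where "Q = max n0 (max g (nat \<lceil>2 * real P / e\<rceil>))"
  have "real (card (E \<inter> {0..<n}) + P) \<le> 4 * e * real n" if n: "n \<ge> Q" for n
  proof -
    have n': "n \<ge> n0" "n \<ge> g" "2 * real P / e \<le> real n" using n unfolding Q_def by linarith+
    have Pn: "real P \<le> e / 2 * real n" using n'(3) e by (simp add: field_simps)
    have "real (n div P) * real g \<le> real n / real P * (e * real P)"
    proof (rule mult_mono)
      show "real (n div P) \<le> real n / real P" by (rule of_nat_div_le_of_nat)
      show "real g \<le> e * real P" using m(2) e mult_nonneg_nonneg[of e "real g"] unfolding P_def of_nat_add distrib_left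
        by linarith
    qed auto
    then have 1: "real (n div P) * real g \<le> e * real n" using P by (simp add: mult.commute)
    have 2: "real g \<le> e / 2 * real n" using Pn by (simp add: P_def)
    have "real (card ({0..<n + g} - G)) * real P \<le> e / (2 * P) * real (n + g) * real P"
      using n0[of "n + g"] n' by (intro mult_right_mono) auto
    also have "\<dots> = e / 2 * real (n + g)" using P by simp
    also have "\<dots> \<le> e / 2 * real (2 * n)" using n' e by (intro mult_left_mono) auto
    finally have 3: "real (card ({0..<n + g} - G)) * real P \<le> e * real n" by simp
    have "real (card (E \<inter> {0..<n})) \<le> real ((n div P + 1) * g + card ({0..<n + g} - G) * P)"
      using card_bad_blocks_le[OF P, of g G n] unfolding E_def by (simp only: of_nat_le_iff)
    also have "\<dots> = real (n div P) * real g + real g + real (card ({0..<n + g} - G)) * real P"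
      by (simp add: algebra_simps)
    finally show ?thesis using 1 2 3 Pn e by (simp add: algebra_simps)
  qed
  moreover have "\<exists>y\<in>M. (\<forall>n<N. d ((T ^^ n) y) ((T ^^ n) z) \<le> e) \<and>
      (\<forall>n. N + P \<le> n \<and> n < N' \<and> n \<notin> E \<longrightarrow> d ((T ^^ n) y) (x n) \<le> 2 * e)"
    if N: "N \<ge> 1" and z: "z \<in> M" for N N' z
  proof -
    \<comment> \<open>Block length 0 makes the approximation say just that \<open>core\<close> is
      nonempty. The point \<open>c0\<close> is a default target for blocks with a bad start.\<close>
    obtain c0 where "c0 \<in> core" using core_approximates[OF e, of 0] z by blast
    then have "\<exists>c\<in>core. P * j + g \<in> G \<longrightarrow> (\<forall>i<m. d (x (P * j + g + i)) ((T ^^ i) c) < e)" for j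
      unfolding G_def by blast
    then obtain c where c: "\<And>j. c j \<in> core"
      "\<And>i j. P * j + g \<in> G \<Longrightarrow> i < m \<Longrightarrow> d (x (P * j + g + i)) ((T ^^ i) (c j)) < e"
      by metis
    have "\<exists>y\<in>M. (\<forall>n<N. d ((T ^^ n) y) ((T ^^ n) z) \<le> e) \<and>
        (\<forall>n. N + P \<le> n \<and> n < N' \<and> g \<le> n mod P \<longrightarrow>
           d ((T ^^ n) y) ((T ^^ (n mod P - g)) (c (n div P))) \<le> e)"
      unfolding P_def by (rule trace[OF N z]) (rule c(1))
    then obtain y where y: "y \<in> M" "\<forall>n<N. d ((T ^^ n) y) ((T ^^ n) z) \<le> e"
      and close: "\<forall>n. N + P \<le> n \<and> n < N' \<and> g \<le> n mod P \<longrightarrow>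
           d ((T ^^ n) y) ((T ^^ (n mod P - g)) (c (n div P))) \<le> e"
      by (elim bexE conjE) (rule that)
    have "d ((T ^^ n) y) (x n) \<le> 2 * e" if n: "N + P \<le> n" "n < N'" "n \<notin> E" for n
    proof -
      have n': "g \<le> n mod P" "P * (n div P) + g \<in> G" using n(3) by (auto simp: E_def)
      have "n mod P < P" using P by simp
      then have "n mod P - g < m" using n'(1) unfolding P_def by linarith
      moreover have "P * (n div P) + g + (n mod P - g) = n" using n'(1) by simp
      ultimately have "d (x n) ((T ^^ (n mod P - g)) (c (n div P))) < e" using c(2)[OF n'(2)] by metis
      moreover have "d ((T ^^ n) y) (x n) \<le> d ((T ^^ n) y) ((T ^^ (n mod P - g)) (c (n div P)))
          + d ((T ^^ (n mod P - g)) (c (n div P))) (x n)"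
        using y(1) c(1) core_subset xM by (intro triangle) auto
      ultimately show ?thesis using close n(1,2) n'(1) commute[of "x n"] by fastforce
    qed
    then show ?thesis using y by blast
  qed
  ultimately show ?thesis by (intro exI[of _ P] exI[of _ E] exI[of _ Q]) blast
qed

section \<open>Successive tracing and the limit point\<close>

lemma vague_pseudo_orbit_traced:
  assumes weak: "weak_specification mtopology d T" and x: "vague_pseudo_orbit mtopology T x"
  shows "\<exists>z\<in>M. \<forall>\<epsilon>>0. density_one {n. d ((T ^^ n) z) (x n) < \<epsilon>}"
proof -
  note xM = vague_pseudo_orbit_in[OF x]
  define traced where "traced k P E \<longleftrightarrow> (\<forall>(N::nat) N' z. N \<ge> 1 \<and> z \<in> M \<longrightarrow>
      (\<exists>y\<in>M. (\<forall>n<N. d ((T ^^ n) y) ((T ^^ n) z) \<le> (1/2) ^ k) \<and>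
        (\<forall>n. N + P \<le> n \<and> n < N' \<and> n \<notin> E \<longrightarrow> d ((T ^^ n) y) (x n) \<le> 2 * (1/2) ^ k)))"
    for k P E
  have "\<exists>P E Q. (\<forall>n\<ge>Q. real (card (E \<inter> {0..<n}) + P) \<le> 4 * (1/2) ^ k * real n) \<and> traced k P E"
    for k
    unfolding traced_def by (rule tracing_step[OF weak x]) simp
  then obtain P E Q
    where card_E: "\<And>k n. n \<ge> Q k \<Longrightarrow> real (card (E k \<inter> {0..<n}) + P k) \<le> 4 * (1/2) ^ k * real n"
    and traced: "\<And>k. traced k (P k) (E k)"
    by metis
  \<comment> \<open>The term \<open>Q (Suc k)\<close> makes the count for \<open>E (Suc k)\<close>
    valid from \<open>N (Suc k)\<close> on, \<open>2 ^ k * v\<close> gives the growth needed for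
    gluing, and \<open>v\<close> with the outer \<open>Suc\<close> gives strict
    monotonicity.\<close>
  define N where "N = rec_nat (Suc (Q 0)) (\<lambda>k v. Suc (Q (Suc k) + 2 ^ k * v + v))"
  have N_Suc: "N (Suc k) = Suc (Q (Suc k) + 2 ^ k * N k + N k)" for k by (simp add: N_def)
  have N_Q: "N k \<ge> Q k \<and> N k \<ge> 1" for k by (cases k) (auto simp: N_def)
  have N_mono: "strict_mono N" by (auto simp: strict_mono_Suc_iff N_Suc)
  define follows where "follows k u v \<longleftrightarrow>
      (\<forall>n<N k. d ((T ^^ n) v) ((T ^^ n) u) \<le> (1/2) ^ k) \<and>
      (\<forall>n. N k + P k \<le> n \<and> n < N (Suc k) \<and> n \<notin> E k \<longrightarrow> d ((T ^^ n) v) (x n) \<le> 2 * (1/2) ^ k)"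
    for k u v
  have "\<exists>z. \<forall>k. z k \<in> M \<and> follows k (z k) (z (Suc k))"
  proof (rule dependent_nat_choice)
    show "\<exists>z. z \<in> M" using xM by blast
    show "\<exists>y. y \<in> M \<and> follows k z y" if "z \<in> M" for z k
      using traced[of k, unfolded traced_def, THEN spec[of _ "N k"], THEN spec[of _ "N (Suc k)"],
          THEN spec[of _ z], THEN mp] N_Q[of k] that
      unfolding follows_def by (simp add: Bex_def)
  qed
  then obtain z where z_all: "\<forall>k. z k \<in> M \<and> follows k (z k) (z (Suc k))" ..
  then have z: "z k \<in> M" for k by blast
  have z_step: "d ((T ^^ n) (z (Suc k))) ((T ^^ n) (z k)) \<le> (1/2) ^ k" if "n < N k" for k n
    using z_all that unfolding follows_def by blast
  have z_x: "d ((T ^^ n) (z (Suc k))) (x n) \<le> 2 * (1/2) ^ k"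
    if "N k + P k \<le> n" "n < N (Suc k)" "n \<notin> E k" for k n
    using z_all that unfolding follows_def by blast
  \<comment> \<open>The right side is the exact geometric sum of the steps from \<open>k\<close> to
    \<open>k + i\<close>, so the induction closes without loss.\<close>
  have z_cauchy: "d ((T ^^ n) (z (k + i))) ((T ^^ n) (z k)) \<le> 2 * (1/2) ^ k - 2 * (1/2) ^ (k + i)"
    if n: "n < N k" for n k i
  proof (induction i)
    case (Suc i)
    have "n < N (k + i)" using n strict_mono_mono[OF N_mono] by (meson le_add1 less_le_trans monoD)
    then have "d ((T ^^ n) (z (k + Suc i))) ((T ^^ n) (z (k + i))) \<le> (1/2) ^ (k + i)"
      using z_step by simp
    moreover have "d ((T ^^ n) (z (k + Suc i))) ((T ^^ n) (z k))
        \<le> d ((T ^^ n) (z (k + Suc i))) ((T ^^ n) (z (k + i))) + d ((T ^^ n) (z (k + i))) ((T ^^ n) (z k))"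
      using z by (intro triangle) auto
    ultimately show ?case using Suc by simp
  qed (simp add: z)
  have "range z \<subseteq> M" using z by blast
  then obtain w r where w: "w \<in> M" and r: "strict_mono r"
    and lim: "limitin mtopology (z \<circ> r) w sequentially"
    using compact unfolding compact_space_sequentially by blast
  \<comment> \<open>The geometric tail contributes 2 and the approach to the limit along the
    subsequence contributes 1.\<close>
  have z_w: "d ((T ^^ n) w) ((T ^^ n) (z k)) \<le> 3 * (1/2) ^ k" if n: "n < N k" for n k
  proof -
    have "\<forall>\<^sub>F i in sequentially. d ((T ^^ n) ((z \<circ> r) i)) ((T ^^ n) w) < (1/2) ^ k"
      by (rule limitin_funpow[OF lim]) simp
    then obtain i where i: "i \<ge> k" "d ((T ^^ n) (z (r i))) ((T ^^ n) w) < (1/2) ^ k"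
      unfolding eventually_sequentially by (metis comp_apply nle_le)
    have "r i \<ge> k" using strict_mono_imp_increasing[OF r, of i] i(1) by simp
    then obtain l where "r i = k + l" using le_Suc_ex by blast
    then have "d ((T ^^ n) (z (r i))) ((T ^^ n) (z k)) \<le> 2 * (1/2) ^ k - 2 * (1/2) ^ (k + l)"
      using z_cauchy[OF n, of l] by simp
    moreover have "(0::real) \<le> (1/2) ^ (k + l)" by simp
    moreover have "d ((T ^^ n) w) ((T ^^ n) (z k))
        \<le> d ((T ^^ n) w) ((T ^^ n) (z (r i))) + d ((T ^^ n) (z (r i))) ((T ^^ n) (z k))"
      using w z by (intro triangle) auto
    ultimately show ?thesis using i(2) commute[of "(T ^^ n) w" "(T ^^ n) (z (r i))"] by linarith
  qed
  \<comment> \<open>Nothing is known on the transition window of length \<open>P k\<close> after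
    \<open>N k\<close>. Its length is already included in the bound \<open>card_E\<close>.\<close>
  define F where "F k = E k \<union> {N k..<N k + P k}" for k
  \<comment> \<open>Stage \<open>k\<close> of the orbit is compared with \<open>z (Suc k)\<close>,
    since \<open>n\<close> is below \<open>N (Suc k)\<close>: the cost is \<open>3 / 2 + 2\<close>,
    rounded up to 4.\<close>
  have w_x: "d ((T ^^ n) w) (x n) \<le> 4 * (1/2) ^ k"
    if n: "N k \<le> n" "n < N (Suc k)" "n \<notin> F k" for n k
  proof -
    have "d ((T ^^ n) w) (x n)
        \<le> d ((T ^^ n) w) ((T ^^ n) (z (Suc k))) + d ((T ^^ n) (z (Suc k))) (x n)"
      using w z xM by (intro triangle) auto
    moreover have "d ((T ^^ n) w) ((T ^^ n) (z (Suc k))) \<le> 3 / 2 * (1/2) ^ k"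
      using z_w[OF n(2)] by simp
    moreover have "d ((T ^^ n) (z (Suc k))) (x n) \<le> 2 * (1/2) ^ k"
      using n by (intro z_x) (auto simp: F_def)
    moreover have "(0::real) \<le> (1/2) ^ k" by simp
    ultimately show ?thesis by linarith
  qed
  have "density_one {n. d ((T ^^ n) w) (x n) < \<epsilon>}" if \<epsilon>: "\<epsilon> > 0" for \<epsilon>
  proof -
    obtain k0 where k0: "(1/2) ^ k0 < \<epsilon> / 4"
      using real_arch_pow_inv[of "\<epsilon> / 4" "1/2"] \<epsilon> by auto
    show ?thesis
    proof (rule density_one_glue[where F = F and C = 4 and ?k0.0 = k0, OF N_mono])
      show "2 ^ k * N k \<le> N (Suc k)" for k by (simp add: N_Suc)
      show "real (card (F k \<inter> {0..<n})) \<le> 4 * (1/2) ^ k * real n" if "N k \<le> n" for k n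
      proof -
        have "card (F k \<inter> {0..<n}) \<le> card (E k \<inter> {0..<n} \<union> {N k..<N k + P k})"
          unfolding F_def by (intro card_mono) auto
        also have "\<dots> \<le> card (E k \<inter> {0..<n}) + P k"
          using card_Un_le[of "E k \<inter> {0..<n}" "{N k..<N k + P k}"] by simp
        finally show ?thesis using card_E[of k n] N_Q[of k] that by linarith
      qed
      show "{N k..<N (Suc k)} - {n. d ((T ^^ n) w) (x n) < \<epsilon>} \<subseteq> F k" if "k \<ge> k0" for k
      proof
        fix n assume n: "n \<in> {N k..<N (Suc k)} - {n. d ((T ^^ n) w) (x n) < \<epsilon>}"
        have "(1/2::real) ^ k \<le> (1/2) ^ k0" using that by (intro power_decreasing) auto
        then have "4 * (1/2) ^ k < \<epsilon>" using k0 by linarith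
        then show "n \<in> F k" using w_x[of k n] n by (force simp: not_less)
      qed
    qed
  qed
  then show ?thesis using w by blast
qed

end

theorem corollary7p7:
  fixes X :: "'a topology" and \<rho> :: "'a \<Rightarrow> 'a \<Rightarrow> real" and T :: "'a \<Rightarrow> 'a"
  assumes "topological_dynamical_system X T"
    and "compatible_metric X \<rho>"
    and "\<And>x y. x \<in> topspace X \<Longrightarrow> y \<in> topspace X \<Longrightarrow> \<rho> x y \<le> 1"
    and "weak_specification X \<rho> T"
  shows "vague_specification X \<rho> T"
proof -
  have top: "Metric_space.mtopology (topspace X) \<rho> = X"
    using assms(2) by (simp add: compatible_metric_def)
  interpret Metric_space "topspace X" \<rho>
    using assms(2) by (simp add: compatible_metric_def)
  interpret compact_dynamics "topspace X" \<rho> T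
    by unfold_locales (use assms(1) in \<open>simp_all add: top topological_dynamical_system_def\<close>)
  show ?thesis
    using vague_pseudo_orbit_traced assms(4) unfolding vague_specification_def top by blast
qed

end
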